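(* Let $G$ be a connected graph with at least two vertices. Then $\mathrm{mpd}(G)\ge 4$ (where the inequality is regarded as true if $\mathrm{mpd}(G)=\infty$).
   Context: Graphs are finite, simple and undirected; $d(u,v)$ denotes the shortest-path distance. Let $G$ be a connected graph and let $\Pi=\{S_1,\dots,S_t\}$ be a partition of $V(G)$ into nonempty parts. For $v\in V(G)$ put $d(v,S_i)=\min\{d(v,x):x\in S_i\}$. The multiset partition representation of $v$ with respect to $\Pi$ is the multiset $r_{mp}(v\mid\Pi)=\{d(v,S_1),\dots,d(v,S_t)\}$ (order ignored, multiplicities kept). $\Pi$ is a resolving multiset partition if $r_{mp}(u\mid\Pi)\ne r_{mp}(v\mid\Pi)$ for all distinct $u,v\in V(G)$. The multiset partition dimension $\mathrm{mpd}(G)$ is the minimum number $t$ of parts of a resolving multiset partition of $G$, and $\mathrm{mpd}(G)=\infty$ if none exists. *)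

theory Defs
  imports
    "Graph_Theory.Graph_Theory"
    "HOL-Library.Disjoint_Sets"
    "HOL-Library.Multiset"
    "HOL-Library.Extended_Nat"
begin

text \<open>A finite simple undirected graph is a \<^term>\<open>graph G\<close> of the Graph Theory entry: a finite
  digraph without loops and without parallel arcs, in which each edge is given by its two
  opposite arcs. The shortest-path distance is the library's \<^term>\<open>wf_digraph.\<mu>\<close> with all
  arc costs equal to 1; it is finite between any two vertices of a connected graph.\<close>

definition gdist :: "('a, 'b) pre_digraph \<Rightarrow> 'a \<Rightarrow> 'a \<Rightarrow> ereal" where
  "gdist G u v = wf_digraph.\<mu> G (\<lambda>_. 1) u v"

lemma gdist_eq_Least:
  assumes "graph G" "reachable G u v"
  shows "gdist G u v = ereal (real (LEAST n. \<exists>p. pre_digraph.awalk G u p v \<and> length p = n))"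
proof -
  interpret graph G by fact
  have cost: "awalk_cost (\<lambda>_. 1) p = real (length p)" for p :: "'b list"
    by (induct p) (simp_all add: awalk_cost_def)
  let ?P = "\<lambda>n. \<exists>p. awalk u p v \<and> length p = n"
  have "\<exists>n. ?P n" using assms(2) by (auto simp: reachable_awalk)
  then have "?P (LEAST n. ?P n)" by (rule LeastI_ex)
  then obtain p where p: "awalk u p v" "length p = (LEAST n. ?P n)" by blast
  have "(LEAST n. ?P n) \<le> length q" if "awalk u q v" for q
    using that by (auto intro: Least_le)
  then show ?thesis
    unfolding gdist_def \<mu>_def cost using p
    by (intro antisym INF_greatest INF_lower2[of p]) auto
qed

definition part_dist :: "('a, 'b) pre_digraph \<Rightarrow> 'a \<Rightarrow> 'a set \<Rightarrow> ereal" where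
  "part_dist G v S = Min (gdist G v ` S)"

definition r_mp :: "('a, 'b) pre_digraph \<Rightarrow> 'a set set \<Rightarrow> 'a \<Rightarrow> ereal multiset" where
  "r_mp G P v = image_mset (part_dist G v) (mset_set P)"

definition resolving_multiset_partition :: "('a, 'b) pre_digraph \<Rightarrow> 'a set set \<Rightarrow> bool" where
  "resolving_multiset_partition G P \<longleftrightarrow>
     partition_on (verts G) P \<and>
     (\<forall>u\<in>verts G. \<forall>v\<in>verts G. u \<noteq> v \<longrightarrow> r_mp G P u \<noteq> r_mp G P v)"

text \<open>The infimum of the empty set in \<^typ>\<open>enat\<close> is \<^term>\<open>\<infinity> :: enat\<close>; any other set
  of \<^typ>\<open>enat\<close> values attains its infimum.\<close>

definition mpd :: "('a, 'b) pre_digraph \<Rightarrow> enat" where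
  "mpd G = (INF P\<in>{P. resolving_multiset_partition G P}. enat (card P))"

end

(* A partition into one part gives every vertex the representation {0}, and for two parts the ends
   of an edge between the parts both get {0, 1}. For three parts, let k be minimal such that some
   vertex w has representation {0, 1, k}; say w lies in A, at distance 1 from B and k from C.
   If k = 1, neighbours of w in B and in C both have representation {0, 1, 1} or {0, 1, 2}, so two
   of the three vertices collide. If k > 1, let y be the last vertex before C on a shortest path
   from w to C: it is adjacent to C, at distance at most k from B if it lies in A, and at distance
   at most k - 1 from A if it lies in B. Minimality of k and injectivity leave only y = w, which
   is not adjacent to C. *)

theory Submission
  imports Defs
begin

section \<open>Distances to sets in a finite natural-valued metric with geodesics\<close>

locale geodesic_nat_metric =
  fixes V :: "'a set" and d :: "'a \<Rightarrow> 'a \<Rightarrow> nat"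
  assumes finite_V: "finite V"
    and d_eq_0_iff: "\<lbrakk>u \<in> V; v \<in> V\<rbrakk> \<Longrightarrow> d u v = 0 \<longleftrightarrow> u = v"
    and d_sym: "\<lbrakk>u \<in> V; v \<in> V\<rbrakk> \<Longrightarrow> d u v = d v u"
    and d_triangle: "\<lbrakk>u \<in> V; v \<in> V; w \<in> V\<rbrakk> \<Longrightarrow> d u w \<le> d u v + d v w"
    and d_penultimate: "\<lbrakk>u \<in> V; v \<in> V; d u v = Suc n\<rbrakk> \<Longrightarrow> \<exists>y\<in>V. d u y = n \<and> d y v = 1"
begin

text \<open>\<open>setd\<close> and \<open>rep\<close> mirror \<open>part_dist\<close> and
  \<open>r_mp\<close> with natural numbers in place of \<open>ereal\<close>, where subtraction-free
  arithmetic and least values are at hand.\<close>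

definition setd :: "'a \<Rightarrow> 'a set \<Rightarrow> nat" where
  "setd v S = Min (d v ` S)"

definition rep :: "'a set set \<Rightarrow> 'a \<Rightarrow> nat multiset" where
  "rep P v = image_mset (setd v) (mset_set P)"

lemma setd_le: "\<lbrakk>S \<subseteq> V; x \<in> S\<rbrakk> \<Longrightarrow> setd v S \<le> d v x"
  unfolding setd_def using finite_V finite_subset by (intro Min_le) auto

lemma setd_attained:
  assumes "S \<subseteq> V" "S \<noteq> {}"
  obtains x where "x \<in> S" "setd v S = d v x"
proof -
  have "Min (d v ` S) \<in> d v ` S"
    using assms finite_V finite_subset by (intro Min_in) auto
  then show thesis using that unfolding setd_def by auto
qed

lemma setd_eq_0_iff:
  assumes "S \<subseteq> V" "S \<noteq> {}" "v \<in> V"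
  shows "setd v S = 0 \<longleftrightarrow> v \<in> S"
proof
  assume "setd v S = 0"
  moreover obtain x where "x \<in> S" "setd v S = d v x" using setd_attained assms by metis
  ultimately show "v \<in> S" using d_eq_0_iff assms by (metis subsetD)
next
  assume "v \<in> S"
  then show "setd v S = 0" using setd_le[of S v v] d_eq_0_iff[of v v] assms by auto
qed

lemma setd_triangle:
  assumes "S \<subseteq> V" "S \<noteq> {}" "u \<in> V" "v \<in> V"
  shows "setd u S \<le> d u v + setd v S"
proof -
  obtain x where "x \<in> S" "setd v S = d v x" using setd_attained assms by metis
  then show ?thesis
    using setd_le[of S x u] d_triangle[of u v x] assms by auto
qed

lemma setd_eq_1:
  assumes "S \<subseteq> V" "u \<in> V" "x \<in> S" "u \<notin> S" "d u x = 1"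
  shows "setd u S = 1"
  using setd_le[of S x u] setd_eq_0_iff[of S u] assms by force

text \<open>Take \<open>x\<close> in \<open>S\<close> nearest to \<open>u\<close> and step back once
  on a geodesic. If \<open>y\<close> were in \<open>S\<close>, it would be nearer to
  \<open>u\<close> than \<open>x\<close>. The case \<open>y = u\<close> can occur.\<close>

lemma penultimate_to_set:
  assumes "S \<subseteq> V" "S \<noteq> {}" "u \<in> V" "u \<notin> S"
  obtains x y where "x \<in> S" "y \<in> V" "y \<notin> S" "setd u S = Suc (d u y)" "d y x = 1"
proof -
  obtain x where x: "x \<in> S" "setd u S = d u x" using setd_attained assms by metis
  obtain n where n: "d u x = Suc n"
    using x setd_eq_0_iff assms by (metis not0_implies_Suc)
  obtain y where y: "y \<in> V" "d u y = n" "d y x = 1"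
    using d_penultimate[OF _ _ n] assms x by blast
  have "y \<notin> S" using setd_le[of S y u] assms x n y by auto
  then show thesis using that x y n by auto
qed

section \<open>Partitions into at most three parts\<close>

lemma partition_onD:
  assumes "partition_on V P" "S \<in> P"
  shows "S \<subseteq> V" "S \<noteq> {}"
  using assms by (auto simp: partition_on_def)

lemma rep_two:
  assumes "A \<noteq> B"
  shows "rep {A, B} v = {#setd v A, setd v B#}"
  using assms by (simp add: rep_def)

lemma rep_three:
  assumes "A \<noteq> B" "A \<noteq> C" "B \<noteq> C"
  shows "rep {A, B, C} v = {#setd v A, setd v B, setd v C#}"
  using assms by (simp add: rep_def)

lemma part_of:
  assumes "partition_on V P" "v \<in> V"
  obtains A where "A \<in> P" "v \<in> A"
  using assms by (auto simp: partition_on_def)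

lemma part_unique:
  assumes "partition_on V P" "A \<in> P" "B \<in> P" "v \<in> A" "v \<in> B"
  shows "A = B"
  using assms by (auto simp: partition_on_def disjoint_def)

lemma not_inj_on_rep_two:
  assumes part: "partition_on V P" and card: "card P = 2"
  shows "\<not> inj_on (rep P) V"
proof -
  obtain A B where P: "P = {A, B}" and ne: "A \<noteq> B"
    using card by (auto simp: card_2_iff)
  have A: "A \<subseteq> V" "A \<noteq> {}" and B: "B \<subseteq> V" "B \<noteq> {}"
    using partition_onD[OF part] P by auto
  have disj: "x \<notin> A \<or> x \<notin> B" for x using part_unique[OF part] P ne by blast
  obtain u where "u \<in> A" "u \<notin> B" using A part_unique[OF part] P ne by blast
  then have "u \<in> V" "u \<notin> B" using A by auto
  then obtain x y where xy: "x \<in> B" "y \<in> V" "y \<notin> B" "setd u B = Suc (d u y)" "d y x = 1"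
    by (rule penultimate_to_set[OF B])
  have "y \<in> A" using part_of[OF part xy(2)] P xy by blast
  have x: "x \<in> V" using xy B by auto
  have "setd y B = 1" using setd_eq_1[of B y x] B xy by auto
  moreover have "setd x A = 1"
    using setd_eq_1[of A x y] A xy x disj \<open>y \<in> A\<close> d_sym[of x y] by auto
  moreover have "setd y A = 0" "setd x B = 0"
    using setd_eq_0_iff A B xy x \<open>y \<in> A\<close> by auto
  \<comment> \<open>The entries 0 and 1 appear in opposite orders for \<open>x\<close> and
    \<open>y\<close>, which a multiset does not see.\<close>
  ultimately have "rep P x = rep P y" by (simp add: P rep_two[OF ne])
  then show ?thesis using x xy by (auto dest: inj_onD)
qed

lemma three_parts_around:
  assumes part: "partition_on V P" and card: "card P = 3"
    and v: "v \<in> V" and rep: "rep P v = {#0, a, b#}"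
  obtains A B C where "P = {A, B, C}" "A \<noteq> B" "A \<noteq> C" "B \<noteq> C"
    "v \<in> A" "setd v B = a" "setd v C = b"
proof -
  obtain A where A: "A \<in> P" "v \<in> A" using part_of[OF part v] .
  have "card (P - {A}) = 2" using A card by (simp add: card_Diff_singleton)
  then obtain B C where BC: "P - {A} = {B, C}" "B \<noteq> C" by (auto simp: card_2_iff)
  then have P: "P = {A, B, C}" and ne: "A \<noteq> B" "A \<noteq> C" using A by auto
  have "setd v A = 0" using setd_eq_0_iff partition_onD[OF part A(1)] v A by blast
  then have "{#setd v B, setd v C#} = {#a, b#}"
    using rep rep_three[OF ne BC(2), of v] P by simp
  \<comment> \<open>The multiset fixes the two remaining distances only up to a swap; the second
    case exchanges the names of \<open>B\<close> and \<open>C\<close>.\<close>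
  then consider "setd v B = a \<and> setd v C = b" | "setd v C = a \<and> setd v B = b"
    by (auto simp: add_eq_conv_ex)
  then show thesis
  proof cases
    case 1
    then show thesis using that[of A B C] P ne BC A by auto
  next
    case 2
    then show thesis using that[of A C B] P ne BC A by auto
  qed
qed

lemma not_inj_on_rep_three:
  assumes part: "partition_on V P" and card: "card P = 3"
  shows "\<not> inj_on (rep P) V"
proof
  assume inj: "inj_on (rep P) V"
  define Q where "Q k \<longleftrightarrow> (\<exists>w\<in>V. rep P w = {#0, 1, k#})" for k
  \<comment> \<open>The labels of the parts stay free, so this fact can be applied with the parts in
    any order.\<close>
  have Q: "Q k" if P: "P = {A, B, C}" and ne: "A \<noteq> B" "A \<noteq> C" "B \<noteq> C"
    and "y \<in> A" "setd y B = 1" "setd y C = k" for A B C y k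
  proof -
    have y: "y \<in> V" using partition_onD[OF part, of A] P that by auto
    have "setd y A = 0" using setd_eq_0_iff[of A y] partition_onD[OF part, of A] P that by blast
    then show ?thesis using y that by (auto simp: Q_def rep_three[OF ne] intro!: bexI[of _ y])
  qed
  have "\<exists>k. Q k"
  proof -
    obtain A B C where P: "P = {A, B, C}" and ne: "A \<noteq> B" "A \<noteq> C" "B \<noteq> C"
      using card by (auto simp: card_3_iff)
    have A: "A \<subseteq> V" "A \<noteq> {}" and B: "B \<subseteq> V" "B \<noteq> {}"
      using partition_onD[OF part] P by auto
    obtain u where "u \<in> A" "u \<notin> B" using A part_unique[OF part] P ne by blast
    then have "u \<in> V" "u \<notin> B" using A by auto
    then obtain x y where xy: "x \<in> B" "y \<in> V" "y \<notin> B" "setd u B = Suc (d u y)" "d y x = 1"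
      by (rule penultimate_to_set[OF B])
    have "setd y B = 1" using setd_eq_1[of B y x] B xy by auto
    moreover have "P = {C, B, A}" using P by auto
    moreover obtain D where "D \<in> P" "y \<in> D" using part_of[OF part xy(2)] .
    \<comment> \<open>In either case \<open>y\<close> has entries 0 and 1, and its distance to the
      third part serves as \<open>k\<close>.\<close>
    then have "y \<in> A \<or> y \<in> C" using P xy by blast
    ultimately show ?thesis using Q P ne by metis
  qed
  define k where "k = (LEAST k. Q k)"
  have "Q k" unfolding k_def by (rule LeastI_ex) fact
  have k_le: "k \<le> j" if "Q j" for j unfolding k_def using that by (rule Least_le)
  obtain w where w: "w \<in> V" and rw: "rep P w = {#0, 1, k#}" using \<open>Q k\<close> by (auto simp: Q_def)
  obtain A B C where P: "P = {A, B, C}" and ne: "A \<noteq> B" "A \<noteq> C" "B \<noteq> C"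
    and wA: "w \<in> A" and wB: "setd w B = 1" and wC: "setd w C = k"
    using three_parts_around[OF part card w rw] .
  have A: "A \<subseteq> V" "A \<noteq> {}" and B: "B \<subseteq> V" "B \<noteq> {}" and C: "C \<subseteq> V" "C \<noteq> {}"
    using partition_onD[OF part] P by auto
  have disj: "x \<notin> A \<or> x \<notin> B" "x \<notin> A \<or> x \<notin> C" "x \<notin> B \<or> x \<notin> C" for x
    using part_unique[OF part] P ne by blast+
  have P': "P = {A, C, B}" "P = {B, C, A}" using P by auto
  show False
  proof (cases "k = 1")
    case True
    obtain b where b: "b \<in> B" "d w b = 1" using setd_attained[OF B, of w] wB by metis
    obtain c where c: "c \<in> C" "d w c = 1" using setd_attained[OF C, of w] wC True by metis
    have bV: "b \<in> V" and cV: "c \<in> V" using b c B C by auto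
    have db: "d b w = 1" and dc: "d c w = 1" using b c w bV cV d_sym by metis+
    have b0: "setd b B = 0" "setd b A = 1"
      using setd_eq_0_iff[of B b] setd_eq_1[of A b w] A B b bV wA db disj by auto
    have c0: "setd c C = 0" "setd c A = 1"
      using setd_eq_0_iff[of C c] setd_eq_1[of A c w] A C c cV wA dc disj by auto
    \<comment> \<open>The bound comes from the detour through \<open>w\<close>, which is adjacent to
      both \<open>B\<close> and \<open>C\<close>.\<close>
    have "setd b C \<le> 2" using setd_triangle[of C b w] C bV w wC db True by auto
    have "setd c B \<le> 2" using setd_triangle[of B c w] B cV w wB dc by auto
    have rb: "rep P b = {#0, 1, setd b C#}" and rc: "rep P c = {#0, 1, setd c B#}"
      using b0 c0 rep_three[OF ne] by (simp_all add: P add_mset_commute)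
    have "b \<noteq> w" "c \<noteq> w" "b \<noteq> c" using b c wA disj by auto
    then have "rep P b \<noteq> rep P w" "rep P c \<noteq> rep P w" "rep P b \<noteq> rep P c"
      using inj bV cV w by (auto dest: inj_onD)
    moreover have "setd b C \<noteq> 0" "setd c B \<noteq> 0"
      using setd_eq_0_iff B C b c bV cV disj by auto
    \<comment> \<open>\<open>w\<close> already has representation {0, 1, 1}, so injectivity rules
      out the value 1 for both neighbours.\<close>
    ultimately have "setd b C = 2" "setd c B = 2"
      using rb rc rw True \<open>setd b C \<le> 2\<close> \<open>setd c B \<le> 2\<close> by (auto simp: le_Suc_eq numeral_2_eq_2)
    then show False using rb rc \<open>rep P b \<noteq> rep P c\<close> by simp
  next
    case False
    have "w \<notin> C" using wA disj by auto
    from penultimate_to_set[OF C w this] obtain x y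
      where xy: "x \<in> C" "y \<in> V" "y \<notin> C" "d y x = 1" and ky: "k = Suc (d w y)"
      using wC by metis
    have yC: "setd y C = 1" using setd_eq_1[of C y x] C xy by auto
    have yw: "d y w = d w y" using d_sym xy w by auto
    obtain D where "D \<in> P" "y \<in> D" using part_of[OF part xy(2)] .
    then consider "y \<in> A" | "y \<in> B" using P xy by auto
    then show False
    proof cases
      case 1
      \<comment> \<open>The detour through \<open>w\<close> costs \<open>k - 1\<close> steps from
        \<open>y\<close> to \<open>w\<close> and one more into \<open>B\<close>.\<close>
      have "setd y B \<le> k" using setd_triangle[of B y w] B xy w wB yw ky by auto
      moreover have "k \<le> setd y B" using Q[OF P'(1)] ne 1 yC k_le by metis
      moreover have "setd y A = 0" using setd_eq_0_iff[of A y] A 1 xy by auto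
      ultimately have "rep P y = rep P w"
        using rw yC rep_three[OF ne] by (simp add: P add_mset_commute)
      then have "y = w" using inj xy w by (auto dest: inj_onD)
      \<comment> \<open>\<open>y\<close> is at distance 1 from \<open>C\<close>, while
        \<open>w\<close> is at distance \<open>k\<close>, which differs from 1 here.\<close>
      then show False using yC wC False by simp
    next
      case 2
      \<comment> \<open>Here \<open>w\<close> itself lies in the target part, so the last step is
        saved and the bound is \<open>k - 1\<close>, below the minimum.\<close>
      have "setd y A \<le> d y w" using setd_le[of A w y] A wA by auto
      moreover have "k \<le> setd y A" using Q[OF P'(2)] ne 2 yC k_le by metis
      ultimately show False using ky yw by simp
    qed
  qed
qed

lemma card_parts_ge_4:
  assumes part: "partition_on V P" and "card V \<ge> 2" and inj: "inj_on (rep P) V"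
  shows "card P \<ge> 4"
proof (rule ccontr)
  assume "\<not> card P \<ge> 4"
  then consider "card P = 0" | "card P = 1" | "card P = 2" | "card P = 3" by linarith
  then show False
  proof cases
    case 1
    \<comment> \<open>\<open>card P = 0\<close> would also hold for infinite \<open>P\<close>;
      finiteness of \<open>V\<close> excludes this.\<close>
    then have "P = {}" using part finite_V by (auto dest: finite_elements)
    then show False using part \<open>card V \<ge> 2\<close> by (auto simp: partition_on_def)
  next
    case 2
    then obtain S where "P = {S}" by (auto simp: card_1_singleton_iff)
    then have P: "P = {V}" using part by (auto simp: partition_on_def)
    obtain u v where uv: "u \<in> V" "v \<in> V" "u \<noteq> v"
      using \<open>card V \<ge> 2\<close> card_le_Suc0_iff_eq[OF finite_V] by auto
    then have "setd u V = 0" "setd v V = 0" using setd_eq_0_iff[of V] by blast+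
    then have "rep P u = rep P v" by (simp add: P rep_def)
    then show False using inj uv by (auto dest: inj_onD)
  qed (use not_inj_on_rep_two not_inj_on_rep_three part inj in auto)
qed

end

section \<open>Lengths of shortest walks as a geodesic metric\<close>

definition hop :: "('a, 'b) pre_digraph \<Rightarrow> 'a \<Rightarrow> 'a \<Rightarrow> nat" where
  "hop G u v = (LEAST n. \<exists>p. pre_digraph.awalk G u p v \<and> length p = n)"

context wf_digraph
begin

lemma hop_le: "awalk u p v \<Longrightarrow> hop G u v \<le> length p"
  unfolding hop_def by (intro Least_le) auto

lemma hop_attained:
  assumes "u \<rightarrow>\<^sup>* v"
  obtains p where "awalk u p v" "length p = hop G u v"
proof -
  have "\<exists>n p. awalk u p v \<and> length p = n" using assms by (auto simp: reachable_awalk)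
  from LeastI_ex[OF this] show thesis using that unfolding hop_def by blast
qed

end

text \<open>Symmetry supplies an opposite for each arc; these opposites, in reverse order, form the
  walk back. This gives the symmetry of \<open>hop\<close>.\<close>

lemma (in sym_digraph) awalk_reverse:
  "awalk u p v \<Longrightarrow> \<exists>q. awalk v q u \<and> length q = length p"
proof (induct p arbitrary: u)
  case Nil
  then show ?case by (auto simp: awalk_Nil_iff)
next
  case (Cons e p)
  then have e: "e \<in> arcs G" "u = tail G e" "awalk (head G e) p v" by (auto simp: awalk_Cons_iff)
  obtain q where q: "awalk v q (head G e)" "length q = length p" using Cons e by blast
  obtain f where "f \<in> arcs G" "tail G f = head G e" "head G f = u"
    using sym_arcs e unfolding symmetric_conv by metis
  then have "awalk v (q @ [f]) u"
    using q by (auto intro!: awalk_appendI simp: awalk_Cons_iff awalk_Nil_iff)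
  then show ?case using q by (intro exI[of _ "q @ [f]"]) auto
qed

text \<open>Connectedness provides a walk between any two vertices, so the \<open>LEAST\<close> in
  \<open>hop\<close> is attained. The axioms then come from reversing, joining and cutting shortest
  walks.\<close>

lemma (in graph) geodesic_nat_metric_hop:
  assumes "connected G"
  shows "geodesic_nat_metric (verts G) (hop G)"
proof
  have walk: "\<exists>p. awalk u p v \<and> length p = hop G u v" if "u \<in> verts G" "v \<in> verts G" for u v
  proof -
    have "u \<rightarrow>\<^sup>* v"
      using symmetric_connected_imp_strongly_connected[OF sym_arcs assms] that
      by (auto elim: strongly_connectedE)
    then show ?thesis using hop_attained by metis
  qed
  have sym_le: "hop G v u \<le> hop G u v" if uv: "u \<in> verts G" "v \<in> verts G" for u v
    using walk[OF uv] awalk_reverse hop_le by metis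
  have triangle: "hop G u w \<le> hop G u v + hop G v w"
    if uvw: "u \<in> verts G" "v \<in> verts G" "w \<in> verts G" for u v w
  proof -
    obtain p q where "awalk u p v" "length p = hop G u v" "awalk v q w" "length q = hop G v w"
      using walk uvw by metis
    then show ?thesis using hop_le[OF awalk_appendI] by (metis length_append)
  qed
  show "finite (verts G)" by simp
  show "hop G u w \<le> hop G u v + hop G v w"
    if "u \<in> verts G" "v \<in> verts G" "w \<in> verts G" for u v w
    using triangle that .
  fix u v assume uv: "u \<in> verts G" "v \<in> verts G"
  obtain p where p: "awalk u p v" "length p = hop G u v" using walk uv by metis
  show "hop G u v = 0 \<longleftrightarrow> u = v"
  proof
    assume "hop G u v = 0"
    then show "u = v" using p by (simp add: awalk_Nil_iff)
  next
    assume "u = v"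
    then show "hop G u v = 0" using hop_le[of u "[]" v] uv by (simp add: awalk_Nil_iff)
  qed
  show "hop G u v = hop G v u" using sym_le uv by (simp add: le_antisym)
  fix n assume n: "hop G u v = Suc n"
  then obtain q e where qe: "p = q @ [e]" "length q = n"
    using p by (metis length_Suc_conv_rev)
  obtain y where y: "awalk u q y" "awalk y [e] v" using p qe by auto
  then have yV: "y \<in> verts G" by auto
  \<comment> \<open>Cutting off the last arc gives upper bounds only; since they add up to
    \<open>hop G u v\<close>, the triangle inequality makes both equalities.\<close>
  have "hop G u y \<le> n" "hop G y v \<le> 1" using hop_le[OF y(1)] hop_le[OF y(2)] qe by auto
  then show "\<exists>y\<in>verts G. hop G u y = n \<and> hop G y v = 1"
    using triangle[OF uv(1) yV uv(2)] n yV by (intro bexI[of _ y]) auto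
qed

text \<open>All distances are finite by connectedness, and the embedding of the naturals into
  \<open>ereal\<close> is monotone, so it commutes with \<open>Min\<close>.\<close>

lemma (in graph) part_dist_eq_Min_hop:
  assumes "connected G" "v \<in> verts G" "S \<subseteq> verts G" "S \<noteq> {}"
  shows "part_dist G v S = ereal (real (Min (hop G v ` S)))"
proof -
  have "finite S" using assms(3) by (rule finite_subset) simp
  have "gdist G v x = ereal (real (hop G v x))" if "x \<in> S" for x
  proof -
    have "v \<rightarrow>\<^sup>* x"
      using symmetric_connected_imp_strongly_connected[OF sym_arcs assms(1)] assms that
      by (auto elim: strongly_connectedE)
    then show ?thesis
      using gdist_eq_Least[OF graph_axioms] by (simp add: hop_def)
  qed
  then have "gdist G v ` S = (\<lambda>n. ereal (real n)) ` (hop G v ` S)"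
    by (auto simp: image_image)
  moreover have "mono (\<lambda>n. ereal (real n))" by (auto simp: mono_def)
  ultimately show ?thesis
    using mono_Min_commute[of "\<lambda>n. ereal (real n)" "hop G v ` S"] \<open>finite S\<close> assms
    by (simp add: part_dist_def)
qed

theorem theorem2p1:
  fixes G :: "('a, 'b) pre_digraph"
  assumes "graph G"
    and "Digraph_Component.connected G"
    and "card (verts G) \<ge> 2"
  shows "mpd G \<ge> 4"
proof -
  interpret graph G by fact
  interpret geodesic_nat_metric "verts G" "hop G"
    using geodesic_nat_metric_hop assms by blast
  have "4 \<le> card P" if P: "resolving_multiset_partition G P" for P
  proof (rule card_parts_ge_4)
    show part: "partition_on (verts G) P" and "2 \<le> card (verts G)"
      using P assms by (auto simp: resolving_multiset_partition_def)
    have fin: "finite P" using finite_V part by (rule finite_elements)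
    \<comment> \<open>This makes \<open>r_mp\<close> a function of \<open>rep\<close>, so vertices
      separated by \<open>r_mp\<close> are separated by \<open>rep\<close>.\<close>
    have "r_mp G P v = image_mset (\<lambda>n. ereal (real n)) (rep P v)" if "v \<in> verts G" for v
    proof -
      have "part_dist G v S = ereal (real (setd v S))" if "S \<in> P" for S
        using part_dist_eq_Min_hop[OF assms(2) \<open>v \<in> verts G\<close> partition_onD[OF part that]]
        by (simp add: setd_def)
      then show ?thesis
        using fin by (auto simp: r_mp_def rep_def multiset.map_comp intro!: image_mset_cong)
    qed
    then show "inj_on (rep P) (verts G)"
      using P unfolding resolving_multiset_partition_def inj_on_def by metis
  qed
  \<comment> \<open>The bound for each resolving partition passes to the infimum; if there is none,
    the infimum is infinite and the bound still holds.\<close>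
  then show ?thesis
    unfolding mpd_def by (intro INF_greatest) (auto simp: numeral_eq_enat)
qed

end
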